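(* Let $u_1=\cos x$, and let $u_n(x)=\sum_{k=2}^n u_{n,k}\cos(kx)$ ($n\ge2$) and $v_n$ ($n\ge0$, $v_0=-1$) be the coefficients determined by the recurrence given in the context. Then the radius of convergence of the power series $$u_\epsilon(x)=\sum_{n=1}^\infty u_n(x)\,\epsilon^n,\qquad v_\epsilon=\sum_{n=0}^\infty v_n\,\epsilon^n$$ (as a power series in $\epsilon$ for the pair $(u_\epsilon,v_\epsilon)$) is not bigger than $\dfrac{2}{e}$.
   Context: The series is the formal expansion of the traveling waves $f(x,t)=u_\epsilon(x+v_\epsilon t)$ of the Burgers--Hilbert equation $f_t=Hf+ff_x$ on $\mathbb T=\mathbb R/2\pi\mathbb Z$, i.e. of solutions of $Hu_\epsilon-v_\epsilon u_\epsilon'+u_\epsilon u_\epsilon'=0$, where $\widehat{Hf}(k)=-i\,\mathrm{sgn}(k)\hat f(k)$. Recurrence: set $u_{1,1}=1$, $u_{n,1}=0$ for $n\ge2$, $v_0=-1$, and $u_{n,k}=0$ if $n-k$ is odd. For $n\ge2$, $$v_{n-1}=\frac12\sum_{m=1}^{n-1}\ \sum_{l=1}^{\min(m,\,n-m-1)}u_{m,l}\,u_{n-m,1+l},$$ and for $2\le k\le n$ with $k\equiv n \pmod 2$, $$(1-k)u_{n,k}+k\sum_{m=1}^{n-k}v_m u_{n-m,k}-\frac k4\sum_{m=1}^{n-1}\ \sum_{l=\max(1,k-n+m)}^{\min(m,k-1)}u_{m,l}u_{n-m,k-l}-\frac k2\sum_{m=1}^{n-1}\ \sum_{l=1}^{\min(m,\,n-m-k)}u_{m,l}u_{n-m,k+l}=0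 .$$ Empty sums are zero. The series for $u_\epsilon$ is regarded as a power series with values in $H^1(\mathbb T)$. *)

theory Defs
  imports "HOL-Analysis.Analysis"
begin

section \<open>The Sobolev space \<open>H\<^sup>1\<close> of the circle\<close>

text \<open>
  Functions on the circle are \<open>2\<pi>\<close>-periodic functions on the real line. Every class in
  \<open>H\<^sup>1\<close> has a unique absolutely continuous representative, so the space is taken to consist
  of the periodic functions which are on \<open>[0, 2\<pi>]\<close> the indefinite integral of a
  square-integrable function; the latter is the weak derivative, unique up to null sets.
\<close>

definition circle :: "real measure" where
  "circle = restrict_space lborel {0..2*pi}"

definition has_weak_deriv :: "(real \<Rightarrow> real) \<Rightarrow> (real \<Rightarrow> real) \<Rightarrow> bool" where
  "has_weak_deriv f g \<longleftrightarrow>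
     (\<forall>x. f (x + 2*pi) = f x) \<and>
     g \<in> borel_measurable circle \<and> integrable circle (\<lambda>t. (g t)\<^sup>2) \<and>
     (\<forall>x\<in>{0..2*pi}. f x = f 0 + (LINT t:{0..x}|circle. g t))"

lemma space_circle [simp]: "space circle = {0..2*pi}"
  by (simp add: circle_def space_restrict_space)

lemma finite_measure_circle: "finite_measure circle"
  unfolding circle_def
  by (intro finite_measureI) (simp add: space_restrict_space emeasure_restrict_space)

interpretation circle: finite_measure circle
  by (rule finite_measure_circle)

lemma measure_circle [simp]: "measure circle {0..2*pi} = 2*pi"
  by (simp add: circle_def measure_restrict_space)

lemma sets_circle: "sets circle = (\<inter>) {0..2*pi} ` sets borel"
  by (simp add: circle_def sets_restrict_space)

lemma borel_measurable_circleI: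
  "f \<in> borel_measurable borel \<Longrightarrow> f \<in> borel_measurable circle"
  unfolding circle_def by (rule measurable_restrict_space1) simp

lemma id_measurable_circle: "(\<lambda>x. x) \<in> borel_measurable circle"
  by (rule borel_measurable_circleI) simp

lemma has_weak_derivD:
  assumes "has_weak_deriv f g"
  shows "f (x + 2*pi) = f x" "g \<in> borel_measurable circle" "integrable circle (\<lambda>t. (g t)\<^sup>2)"
    "integrable circle g"
    "x \<in> {0..2*pi} \<Longrightarrow> f x = f 0 + (LINT t|circle. indicator {0..x} t * g t)"
proof -
  have A: "\<forall>x. f (x + 2*pi) = f x" "g \<in> borel_measurable circle" "integrable circle (\<lambda>t. (g t)\<^sup>2)"
    "\<forall>x\<in>{0..2*pi}. f x = f 0 + (LINT t|circle. indicator {0..x} t * g t)"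
    using assms unfolding has_weak_deriv_def set_lebesgue_integral_def real_scaleR_def by blast+
  show "f (x + 2*pi) = f x" using A(1) by blast
  show "g \<in> borel_measurable circle" "integrable circle (\<lambda>t. (g t)\<^sup>2)" by (fact A)+
  show "integrable circle g" using A(2,3) by (rule circle.square_integrable_imp_integrable)
  show "f x = f 0 + (LINT t|circle. indicator {0..x} t * g t)" if "x \<in> {0..2*pi}"
    using A(4) that by blast
qed

lemma has_weak_derivI:
  assumes "\<And>x. f (x + 2*pi) = f x" "g \<in> borel_measurable circle"
    "integrable circle (\<lambda>t. (g t)\<^sup>2)"
    "\<And>x. x \<in> {0..2*pi} \<Longrightarrow> f x = f 0 + (LINT t|circle. indicator {0..x} t * g t)"
  shows "has_weak_deriv f g"
  using assms unfolding has_weak_deriv_def set_lebesgue_integral_def real_scaleR_def by blast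

lemma integrable_ind:
  fixes g :: "real \<Rightarrow> real"
  assumes "integrable circle g" "A \<in> sets borel"
  shows "integrable circle (\<lambda>t. indicator A t * g t)"
proof (rule Bochner_Integration.integrable_bound[OF assms(1)])
  have "indicator A \<in> borel_measurable circle"
    using assms(2) by (intro borel_measurable_circleI borel_measurable_indicator)
  then show "(\<lambda>t. indicator A t * g t) \<in> borel_measurable circle"
    using borel_measurable_integrable[OF assms(1)] by (rule borel_measurable_times)
qed (simp add: indicator_def)

lemma integrable_prod_square:
  fixes f g :: "'a \<Rightarrow> real"
  assumes [measurable]: "f \<in> borel_measurable M" "g \<in> borel_measurable M"
    and "integrable M (\<lambda>x. (f x)\<^sup>2)" "integrable M (\<lambda>x. (g x)\<^sup>2)"
  shows "integrable M (\<lambda>x. f x * g x)"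
proof (rule Bochner_Integration.integrable_bound)
  show "integrable M (\<lambda>x. (f x)\<^sup>2 + (g x)\<^sup>2)"
    using assms by simp
  have "\<bar>a * b\<bar> \<le> a\<^sup>2 + b\<^sup>2" for a b :: real
  proof -
    have "2 * (\<bar>a\<bar> * \<bar>b\<bar>) \<le> \<bar>a\<bar>\<^sup>2 + \<bar>b\<bar>\<^sup>2"
      using zero_le_power2[of "\<bar>a\<bar> - \<bar>b\<bar>"] by (simp add: power2_diff)
    moreover have "0 \<le> \<bar>a\<bar> * \<bar>b\<bar>" by simp
    ultimately have "\<bar>a\<bar> * \<bar>b\<bar> \<le> \<bar>a\<bar>\<^sup>2 + \<bar>b\<bar>\<^sup>2"
      by linarith
    then show ?thesis
      by (simp add: abs_mult)
  qed
  then show "AE x in M. norm (f x * g x) \<le> norm ((f x)\<^sup>2 + (g x)\<^sup>2)"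
    by simp
qed measurable

lemma has_weak_deriv_bound:
  assumes "has_weak_deriv f g" "x \<in> {0..2*pi}"
  shows "\<bar>f x - f 0\<bar> \<le> (LINT t|circle. \<bar>g t\<bar>)"
proof -
  note D = has_weak_derivD[OF assms(1)]
  have "\<bar>f x - f 0\<bar> = \<bar>LINT t|circle. indicator {0..x} t * g t\<bar>"
    using D(5)[OF assms(2)] by simp
  also have "\<dots> \<le> (LINT t|circle. \<bar>indicator {0..x} t * g t\<bar>)"
    using integral_norm_bound[of circle "\<lambda>t. indicator {0..x} t * g t"] by simp
  also have "\<dots> \<le> (LINT t|circle. \<bar>g t\<bar>)"
    using D(4) by (intro integral_mono integrable_abs integrable_ind) (auto simp: indicator_def)
  finally show ?thesis .
qed

lemma has_weak_deriv_measurable: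
  assumes "has_weak_deriv f g"
  shows "f \<in> borel_measurable circle"
proof -
  note D = has_weak_derivD[OF assms]
  have [measurable]: "(\<lambda>p. fst p) \<in> borel_measurable (circle \<Otimes>\<^sub>M circle)"
    by (rule measurable_compose[OF measurable_fst id_measurable_circle])
  have [measurable]: "(\<lambda>p. snd p) \<in> borel_measurable (circle \<Otimes>\<^sub>M circle)"
    by (rule measurable_compose[OF measurable_snd id_measurable_circle])
  have [measurable]: "(\<lambda>p. g (snd p)) \<in> borel_measurable (circle \<Otimes>\<^sub>M circle)"
    by (rule measurable_compose[OF measurable_snd D(2)])
  have "(\<lambda>p. if 0 \<le> snd p \<and> snd p \<le> fst p then g (snd p) else 0)
      \<in> borel_measurable (circle \<Otimes>\<^sub>M circle)"
    by measurable
  then have "(\<lambda>x. LINT t|circle. (if 0 \<le> t \<and> t \<le> x then g t else 0)) \<in> borel_measurable circle"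
    by (intro circle.borel_measurable_lebesgue_integral) (simp add: case_prod_beta')
  then have "(\<lambda>x. f 0 + (LINT t|circle. (if 0 \<le> t \<and> t \<le> x then g t else 0))) \<in> borel_measurable circle"
    by (intro borel_measurable_add borel_measurable_const)
  moreover have "f x = f 0 + (LINT t|circle. (if 0 \<le> t \<and> t \<le> x then g t else 0))"
    if "x \<in> space circle" for x
  proof -
    have "(\<lambda>t. indicator {0..x} t * g t) = (\<lambda>t. if 0 \<le> t \<and> t \<le> x then g t else 0)"
      by (auto simp: indicator_def)
    then show ?thesis
      using D(5)[of x] that by simp
  qed
  ultimately show ?thesis
    by (simp only: measurable_cong[of circle f "\<lambda>x. f 0 + (LINT t|circle. (if 0 \<le> t \<and> t \<le> x then g t else 0))" borel])
qed

lemma has_weak_deriv_square_integrable: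
  assumes "has_weak_deriv f g"
  shows "integrable circle (\<lambda>x. (f x)\<^sup>2)"
proof (rule circle.integrable_const_bound)
  show "AE x in circle. norm ((f x)\<^sup>2) \<le> (\<bar>f 0\<bar> + (LINT t|circle. \<bar>g t\<bar>))\<^sup>2"
  proof (rule AE_I2)
    fix x assume "x \<in> space circle"
    then have "\<bar>f x\<bar> \<le> \<bar>f 0\<bar> + (LINT t|circle. \<bar>g t\<bar>)"
      using has_weak_deriv_bound[OF assms, of x] by simp
    then show "norm ((f x)\<^sup>2) \<le> (\<bar>f 0\<bar> + (LINT t|circle. \<bar>g t\<bar>))\<^sup>2"
      using power_mono[of "\<bar>f x\<bar>" _ 2] by simp
  qed
  show "(\<lambda>x. (f x)\<^sup>2) \<in> borel_measurable circle"
    using has_weak_deriv_measurable[OF assms] by measurable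
qed

lemma AE_circle_neq: "AE x in circle. x \<noteq> a"
  unfolding circle_def
  by (subst AE_restrict_space_iff) (auto intro: AE_mp[OF AE_lborel_singleton[of a]])

lemma AE_zero_circle:
  fixes g :: "real \<Rightarrow> real"
  assumes g: "integrable circle g"
    and zero: "\<And>x. x \<in> {0..2*pi} \<Longrightarrow> (LINT t|circle. indicator {0..x} t * g t) = 0"
  shows "AE x in circle. g x = 0"
proof (rule circle.density_zero[OF g])
  have [measurable]: "g \<in> borel_measurable circle" using g by simp
  note ind = integrable_ind[OF g]
  have zero': "(LINT t|circle. indicator {..x} t * g t) = 0" for x
  proof (cases "x < 0")
    case True
    have "(LINT t|circle. indicator {..x} t * g t) = (LINT t|circle. 0)"
      using True by (intro Bochner_Integration.integral_cong) (auto simp: indicator_def)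
    then show ?thesis by simp
  next
    case False
    have "(LINT t|circle. indicator {..x} t * g t)
        = (LINT t|circle. indicator {0..min x (2*pi)} t * g t)"
      by (intro Bochner_Integration.integral_cong) (auto simp: indicator_def)
    also have "\<dots> = 0"
      using False by (intro zero) auto
    finally show ?thesis .
  qed
  have borel: "(LINT t|circle. indicator A t * g t) = 0" if "A \<in> sets borel" for A
    using that
  proof (induction A rule: borel_set_induct)
    case empty
    then show ?case by simp
  next
    case (interval a b)
    have "(LINT t|circle. indicator {a..b} t * g t)
        = (LINT t|circle. indicator {..b} t * g t - indicator {..a} t * g t)"
    proof (rule integral_cong_AE)
      show "AE t in circle. indicator {a..b} t * g t = indicator {..b} t * g t - indicator {..a} t * g t"
        by (rule AE_mp[OF AE_circle_neq[of a]], rule AE_I2) (use interval in \<open>auto simp: indicator_def\<close>)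
    qed (use ind in auto)
    also have "\<dots> = 0"
      using zero' ind by simp
    finally show ?case .
  next
    case (compl A)
    have "(LINT t|circle. indicator (- A) t * g t)
        = (LINT t|circle. indicator {..2*pi} t * g t - indicator A t * g t)"
      by (intro Bochner_Integration.integral_cong) (auto simp: indicator_def)
    also have "\<dots> = 0"
      using zero' ind compl by simp
    finally show ?case .
  next
    case (union f)
    have "set_lebesgue_integral circle (\<Union>i. {0..2*pi} \<inter> f i) g
        = (\<Sum>i. set_lebesgue_integral circle ({0..2*pi} \<inter> f i) g)"
    proof (rule lebesgue_integral_countable_add)
      show "{0..2*pi} \<inter> f i \<in> sets circle" for i
        using union by (auto simp: sets_circle)
      show "({0..2*pi} \<inter> f i) \<inter> ({0..2*pi} \<inter> f j) = {}" if "i \<noteq> j" for i j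
        using union(1) that by (auto simp: disjoint_family_on_def)
      show "set_integrable circle (\<Union>i. {0..2*pi} \<inter> f i) g"
        unfolding set_integrable_def real_scaleR_def
        by (rule ind) (use union in auto)
    qed
    moreover have "set_lebesgue_integral circle ({0..2*pi} \<inter> f i) g
        = (LINT t|circle. indicator (f i) t * g t)" for i
      unfolding set_lebesgue_integral_def
      by (intro Bochner_Integration.integral_cong) (auto simp: indicator_def)
    moreover have "set_lebesgue_integral circle (\<Union>i. {0..2*pi} \<inter> f i) g
        = (LINT t|circle. indicator (\<Union>i. f i) t * g t)"
      unfolding set_lebesgue_integral_def
      by (intro Bochner_Integration.integral_cong) (auto simp: indicator_def)
    ultimately show ?case
      using union by simp
  qed
  show "set_lebesgue_integral circle A g = 0" if "A \<in> sets circle" for A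
  proof -
    from that obtain B where B: "B \<in> sets borel" "A = {0..2*pi} \<inter> B"
      by (auto simp: sets_circle)
    have "set_lebesgue_integral circle A g = (LINT t|circle. indicator B t * g t)"
      unfolding set_lebesgue_integral_def B
      by (intro Bochner_Integration.integral_cong) (auto simp: indicator_def)
    then show ?thesis
      using borel[OF B(1)] by simp
  qed
qed

lemma has_weak_deriv_unique:
  assumes "has_weak_deriv f g" "has_weak_deriv f h"
  shows "AE x in circle. g x = h x"
proof -
  note G = has_weak_derivD[OF assms(1)] and H = has_weak_derivD[OF assms(2)]
  have "AE x in circle. g x - h x = 0"
  proof (rule AE_zero_circle)
    show "integrable circle (\<lambda>x. g x - h x)"
      using G(4) H(4) by simp
    fix x :: real assume x: "x \<in> {0..2*pi}"
    have "(LINT t|circle. indicator {0..x} t * (g t - h t))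
        = (LINT t|circle. indicator {0..x} t * g t) - (LINT t|circle. indicator {0..x} t * h t)"
      using G(4) H(4) by (simp add: right_diff_distrib integrable_ind)
    then show "(LINT t|circle. indicator {0..x} t * (g t - h t)) = 0"
      using G(5)[OF x] H(5)[OF x] by simp
  qed
  then show ?thesis by simp
qed

lemma has_weak_deriv_zero: "has_weak_deriv (\<lambda>x. 0) (\<lambda>x. 0)"
  by (rule has_weak_derivI) auto

lemma has_weak_deriv_add:
  assumes "has_weak_deriv f g" "has_weak_deriv f' g'"
  shows "has_weak_deriv (\<lambda>x. f x + f' x) (\<lambda>x. g x + g' x)"
proof (rule has_weak_derivI)
  note G = has_weak_derivD[OF assms(1)] and H = has_weak_derivD[OF assms(2)]
  show "f (x + 2*pi) + f' (x + 2*pi) = f x + f' x" for x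
    using G(1) H(1) by simp
  show "(\<lambda>x. g x + g' x) \<in> borel_measurable circle"
    using G(2) H(2) by simp
  show "integrable circle (\<lambda>t. (g t + g' t)\<^sup>2)"
    using G(2,3) H(2,3) integrable_prod_square[of g circle g'] by (simp add: power2_sum mult.assoc)
  show "f x + f' x = f 0 + f' 0 + (LINT t|circle. indicator {0..x} t * (g t + g' t))"
    if "x \<in> {0..2*pi}" for x
    using G(4) H(4) G(5)[OF that] H(5)[OF that] by (simp add: distrib_left integrable_ind)
qed

lemma has_weak_deriv_scale:
  assumes "has_weak_deriv f g"
  shows "has_weak_deriv (\<lambda>x. c * f x) (\<lambda>x. c * g x)"
proof (rule has_weak_derivI)
  note G = has_weak_derivD[OF assms]
  show "c * f (x + 2*pi) = c * f x" for x
    using G(1) by simp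
  show "(\<lambda>x. c * g x) \<in> borel_measurable circle"
    using G(2) by simp
  show "integrable circle (\<lambda>t. (c * g t)\<^sup>2)"
    using G(3) by (simp add: power_mult_distrib)
  show "c * f x = c * f 0 + (LINT t|circle. indicator {0..x} t * (c * g t))"
    if "x \<in> {0..2*pi}" for x
    using G(5)[OF that] by (simp add: distrib_left mult.left_commute)
qed

lemma has_weak_deriv_diff:
  assumes "has_weak_deriv f g" "has_weak_deriv f' g'"
  shows "has_weak_deriv (\<lambda>x. f x - f' x) (\<lambda>x. g x - g' x)"
  using has_weak_deriv_add[OF assms(1) has_weak_deriv_scale[OF assms(2), of "-1"]] by simp

lemma has_weak_deriv_C1:
  assumes per: "\<And>x. f (x + 2*pi) = f x"
    and der: "\<And>x. (f has_real_derivative g x) (at x)"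
    and cont: "continuous_on UNIV g"
  shows "has_weak_deriv f g"
proof (rule has_weak_derivI)
  show meas: "g \<in> borel_measurable circle"
    using cont by (intro borel_measurable_circleI borel_measurable_continuous_onI)
  have "compact ((\<lambda>x. (g x)\<^sup>2) ` {0..2*pi})"
    by (intro compact_continuous_image continuous_intros continuous_on_subset[OF cont]) auto
  then have "bounded ((\<lambda>x. (g x)\<^sup>2) ` {0..2*pi})"
    by (rule compact_imp_bounded)
  then obtain B where "\<forall>y\<in>(\<lambda>x. (g x)\<^sup>2) ` {0..2*pi}. norm y \<le> B"
    unfolding bounded_iff by blast
  then show "integrable circle (\<lambda>t. (g t)\<^sup>2)"
    using meas by (intro circle.integrable_const_bound[of _ B]) auto
  show "f x = f 0 + (LINT t|circle. indicator {0..x} t * g t)" if x: "x \<in> {0..2*pi}" for x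
  proof -
    have "(LINT t|circle. indicator {0..x} t * g t) = (LINT t|lborel. indicator {0..x} t *\<^sub>R g t)"
      unfolding circle_def
      by (subst integral_restrict_space)
         (use x in \<open>auto intro!: Bochner_Integration.integral_cong simp: indicator_def\<close>)
    also have "\<dots> = f x - f 0"
      using x der
      by (intro integral_FTC_atLeastAtMost continuous_on_subset[OF cont])
         (auto simp: has_real_derivative_iff_has_vector_derivative
               intro: has_vector_derivative_at_within)
    finally show ?thesis by simp
  qed
qed (rule per)

typedef H1 = "{f. \<exists>g. has_weak_deriv f g}"
  morphisms H1_fun Abs_H1
  using has_weak_deriv_zero by blast

setup_lifting type_definition_H1

definition weak_deriv :: "H1 \<Rightarrow> real \<Rightarrow> real" where
  "weak_deriv f = (SOME g. has_weak_deriv (H1_fun f) g)"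

lemma has_weak_deriv_weak_deriv: "has_weak_deriv (H1_fun f) (weak_deriv f)"
proof -
  have "\<exists>g. has_weak_deriv (H1_fun f) g"
    using H1_fun[of f] by simp
  then show ?thesis
    unfolding weak_deriv_def by (rule someI_ex)
qed

instantiation H1 :: real_vector
begin

lift_definition zero_H1 :: H1 is "\<lambda>x. 0"
  using has_weak_deriv_zero by blast

lift_definition plus_H1 :: "H1 \<Rightarrow> H1 \<Rightarrow> H1" is "\<lambda>f g x. f x + g x"
  using has_weak_deriv_add by blast

lift_definition uminus_H1 :: "H1 \<Rightarrow> H1" is "\<lambda>f x. - f x"
  using has_weak_deriv_scale[where c = "-1"] by fastforce

lift_definition minus_H1 :: "H1 \<Rightarrow> H1 \<Rightarrow> H1" is "\<lambda>f g x. f x - g x"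
  using has_weak_deriv_diff by blast

lift_definition scaleR_H1 :: "real \<Rightarrow> H1 \<Rightarrow> H1" is "\<lambda>c f x. c * f x"
  using has_weak_deriv_scale by blast

instance
  by standard (transfer; auto simp: algebra_simps)+

end

instantiation H1 :: real_inner
begin

definition inner_H1 :: "H1 \<Rightarrow> H1 \<Rightarrow> real" where
  "inner_H1 f g = (LINT x|circle. H1_fun f x * H1_fun g x + weak_deriv f x * weak_deriv g x)"

definition norm_H1 :: "H1 \<Rightarrow> real" where
  "norm_H1 f = sqrt (f \<bullet> f)"

definition dist_H1 :: "H1 \<Rightarrow> H1 \<Rightarrow> real" where
  "dist_H1 f g = norm (f - g)"

definition sgn_H1 :: "H1 \<Rightarrow> H1" where
  "sgn_H1 f = f /\<^sub>R norm f"

definition uniformity_H1 :: "(H1 \<times> H1) filter" where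
  "uniformity_H1 = (INF e\<in>{0 <..}. principal {(x, y). dist x y < e})"

definition open_H1 :: "H1 set \<Rightarrow> bool" where
  "open_H1 U \<longleftrightarrow> (\<forall>x\<in>U. eventually (\<lambda>(x', y). x' = x \<longrightarrow> y \<in> U) uniformity)"

lemma inner_H1_eq:
  assumes "has_weak_deriv (H1_fun f) f'" "has_weak_deriv (H1_fun g) g'"
  shows "f \<bullet> g = (LINT x|circle. H1_fun f x * H1_fun g x) + (LINT x|circle. f' x * g' x)"
proof -
  note W = has_weak_deriv_weak_deriv
  have "f \<bullet> g = (LINT x|circle. H1_fun f x * H1_fun g x)
      + (LINT x|circle. weak_deriv f x * weak_deriv g x)"
    unfolding inner_H1_def
    by (intro Bochner_Integration.integral_add integrable_prod_square
              has_weak_deriv_measurable[OF W] has_weak_deriv_square_integrable[OF W]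
              has_weak_derivD[OF W])
  moreover have "(LINT x|circle. weak_deriv f x * weak_deriv g x) = (LINT x|circle. f' x * g' x)"
  proof (rule integral_cong_AE)
    show "AE x in circle. weak_deriv f x * weak_deriv g x = f' x * g' x"
      using has_weak_deriv_unique[OF W assms(1)] has_weak_deriv_unique[OF W assms(2)]
      by eventually_elim simp
  qed (use has_weak_derivD(2)[OF W] has_weak_derivD(2)[OF assms(1)] has_weak_derivD(2)[OF assms(2)]
        in auto)
  ultimately show ?thesis by simp
qed

instance
proof
  fix f g h :: H1 and r :: real
  note W = has_weak_deriv_weak_deriv
  note int = integrable_prod_square[OF has_weak_deriv_measurable[OF W] has_weak_deriv_measurable[OF W]
      has_weak_deriv_square_integrable[OF W] has_weak_deriv_square_integrable[OF W]]
  note int' = integrable_prod_square[OF has_weak_derivD(2)[OF W] has_weak_derivD(2)[OF W]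
      has_weak_derivD(3)[OF W] has_weak_derivD(3)[OF W]]
  show "dist f g = norm (f - g)"
    by (rule dist_H1_def)
  show "sgn f = f /\<^sub>R norm f"
    by (rule sgn_H1_def)
  show "uniformity = (INF e\<in>{0 <..}. principal {(x::H1, y). dist x y < e})"
    by (rule uniformity_H1_def)
  show "open U \<longleftrightarrow> (\<forall>x\<in>U. eventually (\<lambda>(x', y). x' = x \<longrightarrow> y \<in> U) uniformity)" for U :: "H1 set"
    by (rule open_H1_def)
  show "norm f = sqrt (f \<bullet> f)"
    by (rule norm_H1_def)
  show "f \<bullet> g = g \<bullet> f"
    by (simp add: inner_H1_def mult.commute)
  have "has_weak_deriv (H1_fun (f + g)) (\<lambda>x. weak_deriv f x + weak_deriv g x)"
    by (simp add: plus_H1.rep_eq has_weak_deriv_add W)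
  from inner_H1_eq[OF this W[of h]] show "(f + g) \<bullet> h = f \<bullet> h + g \<bullet> h"
    unfolding inner_H1_eq[OF W[of f] W[of h]] inner_H1_eq[OF W[of g] W[of h]]
    by (simp only: plus_H1.rep_eq distrib_right Bochner_Integration.integral_add[OF int int]
          Bochner_Integration.integral_add[OF int' int'])
  have "has_weak_deriv (H1_fun (r *\<^sub>R f)) (\<lambda>x. r * weak_deriv f x)"
    by (simp add: scaleR_H1.rep_eq has_weak_deriv_scale W)
  from inner_H1_eq[OF this W[of g]] show "(r *\<^sub>R f) \<bullet> g = r * (f \<bullet> g)"
    unfolding inner_H1_eq[OF W[of f] W[of g]]
    by (simp only: scaleR_H1.rep_eq distrib_left mult.assoc Bochner_Integration.integral_mult_right_zero)
  show nonneg: "0 \<le> f \<bullet> f"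
    unfolding inner_H1_def by (intro integral_nonneg_AE) auto
  show "f \<bullet> f = 0 \<longleftrightarrow> f = 0"
  proof
    assume "f \<bullet> f = 0"
    then have sum0: "(LINT x|circle. H1_fun f x * H1_fun f x)
        + (LINT x|circle. weak_deriv f x * weak_deriv f x) = 0"
      by (simp add: inner_H1_eq[OF W W])
    have "0 \<le> (LINT x|circle. H1_fun f x * H1_fun f x)"
        "0 \<le> (LINT x|circle. weak_deriv f x * weak_deriv f x)"
      by (intro integral_nonneg_AE; simp)+
    with sum0 have 0: "(LINT x|circle. H1_fun f x * H1_fun f x) = 0"
        "(LINT x|circle. weak_deriv f x * weak_deriv f x) = 0"
      by linarith+
    have "AE x in circle. weak_deriv f x * weak_deriv f x = 0"
      using integral_nonneg_eq_0_iff_AE[OF int'] 0(2) by auto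
    then have d0: "AE x in circle. weak_deriv f x = 0"
      by simp
    have const: "H1_fun f x = H1_fun f 0" if "x \<in> {0..2*pi}" for x
    proof -
      have "(LINT t|circle. indicator {0..x} t * weak_deriv f t) = 0"
        by (rule integral_eq_zero_AE) (use d0 in \<open>eventually_elim, auto\<close>)
      then show ?thesis
        using has_weak_derivD(5)[OF W that, of f] by simp
    qed
    have "(LINT x|circle. H1_fun f x * H1_fun f x) = (LINT x|circle. H1_fun f 0 * H1_fun f 0)"
    proof (intro Bochner_Integration.integral_cong refl)
      fix x assume "x \<in> space circle"
      then have "H1_fun f x = H1_fun f 0" by (intro const) simp
      then show "H1_fun f x * H1_fun f x = H1_fun f 0 * H1_fun f 0" by (simp only:)
    qed
    with 0(1) have f0: "H1_fun f 0 = 0"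
      by simp
    have "H1_fun f x = 0" for x
    proof -
      have per: "H1_fun f (y + 2*pi * of_int k) = H1_fun f y" for y k
      proof (induction k rule: int_induct[where k = 0])
        case base
        then show ?case by simp
      next
        case (step1 i)
        then show ?case
          using has_weak_derivD(1)[OF W, of f "y + 2*pi * of_int i"] by (simp add: algebra_simps)
      next
        case (step2 i)
        then show ?case
          using has_weak_derivD(1)[OF W, of f "y + 2*pi * of_int (i - 1)"]
          by (simp add: algebra_simps)
      qed
      define k where "k = \<lfloor>x / (2*pi)\<rfloor>"
      have "of_int k * (2*pi) \<le> x" "x < (of_int k + 1) * (2*pi)"
        unfolding k_def by (rule floor_divide_lower floor_divide_upper; simp)+
      then have "x - 2*pi * of_int k \<in> {0..2*pi}"
        by (auto simp: algebra_simps)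
      then show ?thesis
        using const[of "x - 2*pi * of_int k"] f0 per[of "x - 2*pi * of_int k" k] by simp
    qed
    then show "f = 0"
      by (intro H1_fun_inject[THEN iffD1] ext) (simp add: zero_H1.rep_eq)
  next
    assume "f = 0"
    then show "f \<bullet> f = 0"
      using inner_H1_eq[of 0 "\<lambda>x. 0" 0 "\<lambda>x. 0"] has_weak_deriv_zero by (simp add: zero_H1.rep_eq)
  qed
qed

end

lemma norm_H1_eq:
  assumes "has_weak_deriv (H1_fun f) f'"
  shows "(norm f)\<^sup>2 = (LINT x|circle. (H1_fun f x)\<^sup>2) + (LINT x|circle. (f' x)\<^sup>2)"
  unfolding power2_norm_eq_inner inner_H1_eq[OF assms assms] by (simp add: power2_eq_square)


lemma (in finite_measure) L2_complete:
  fixes g :: "nat \<Rightarrow> 'a \<Rightarrow> real"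
  assumes meas [measurable]: "\<And>n. g n \<in> borel_measurable M"
    and int: "\<And>n. integrable M (\<lambda>x. (g n x)\<^sup>2)"
    and cauchy: "\<And>e. e > 0 \<Longrightarrow> \<exists>N. \<forall>m\<ge>N. \<forall>n\<ge>N. (LINT x|M. (g m x - g n x)\<^sup>2) < e"
  obtains h where "h \<in> borel_measurable M" "integrable M (\<lambda>x. (h x)\<^sup>2)"
    "(\<lambda>n. LINT x|M. (g n x - h x)\<^sup>2) \<longlonglongrightarrow> 0"
proof -
  have int_diff: "integrable M (\<lambda>x. (g m x - g n x)\<^sup>2)" for m n
    using int integrable_prod_square[of "g m" M "g n"] by (simp add: power2_diff mult.assoc)
  have "\<forall>k. \<exists>N. \<forall>m\<ge>N. \<forall>n\<ge>N. (LINT x|M. (g m x - g n x)\<^sup>2) < (1/4) ^ k"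
    by (intro allI cauchy) simp
  then obtain N where N: "\<And>k m n. m \<ge> N k \<Longrightarrow> n \<ge> N k \<Longrightarrow> (LINT x|M. (g m x - g n x)\<^sup>2) < (1/4) ^ k"
    by metis
  define r where "r k = (\<Sum>i\<le>k. N i)" for k
  have r_ge: "N j \<le> r k" if "j \<le> k" for j k
    unfolding r_def using that by (intro member_le_sum) auto
  define d where "d k x = g (r (Suc k)) x - g (r k) x" for k x
  have [measurable]: "d k \<in> borel_measurable M" for k
    unfolding d_def by measurable
  have d_int2: "integrable M (\<lambda>x. (d k x)\<^sup>2)" for k
    unfolding d_def by (rule int_diff)
  have d_int: "integrable M (d k)" for k
    by (rule square_integrable_imp_integrable[OF _ d_int2]) measurable
  define \<mu> where "\<mu> = measure M (space M)"
  have d_bound: "(LINT x|M. \<bar>d k x\<bar>) \<le> (1/2) ^ k * (1 + \<mu>)" for k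
  proof -
    have pt: "\<bar>a\<bar> \<le> 2 ^ k * a\<^sup>2 + (1/2) ^ k" for a :: real
    proof (cases "\<bar>a\<bar> \<le> (1/2) ^ k")
      case True
      then show ?thesis by (simp add: add_increasing)
    next
      case False
      then have "1 \<le> 2 ^ k * \<bar>a\<bar>"
        by (simp add: power_one_over field_simps)
      then have "\<bar>a\<bar> * 1 \<le> \<bar>a\<bar> * (2 ^ k * \<bar>a\<bar>)"
        by (intro mult_left_mono) auto
      also have "\<dots> = 2 ^ k * a\<^sup>2"
        by (simp add: power2_eq_square)
      finally show ?thesis by (simp add: add_increasing2)
    qed
    have "(LINT x|M. \<bar>d k x\<bar>) \<le> (LINT x|M. 2 ^ k * (d k x)\<^sup>2 + (1/2) ^ k)"
      using d_int d_int2 pt by (intro integral_mono) auto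
    also have "\<dots> = 2 ^ k * (LINT x|M. (d k x)\<^sup>2) + (1/2) ^ k * \<mu>"
      using d_int2 by (subst Bochner_Integration.integral_add) (auto simp: \<mu>_def)
    also have "\<dots> \<le> 2 ^ k * (1/4) ^ k + (1/2) ^ k * \<mu>"
      using N[of k "r (Suc k)" "r k"] r_ge[of k] unfolding d_def
      by (intro add_mono mult_left_mono less_imp_le) auto
    also have "(2::real) ^ k * (1/4) ^ k = (1/2) ^ k"
      by (simp flip: power_mult_distrib)
    finally show ?thesis by (simp add: distrib_left)
  qed
  have "(\<integral>\<^sup>+x. (\<Sum>k. ennreal \<bar>d k x\<bar>) \<partial>M) = (\<Sum>k. \<integral>\<^sup>+x. ennreal \<bar>d k x\<bar> \<partial>M)"
    by (rule nn_integral_suminf) measurable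
  also have "\<dots> \<le> (\<Sum>k. ennreal ((1/2) ^ k * (1 + \<mu>)))"
    using d_int d_bound
    by (intro suminf_le) (auto simp: nn_integral_eq_integral intro!: ennreal_leI)
  also have "\<dots> = ennreal (\<Sum>k. (1/2) ^ k * (1 + \<mu>))"
    by (intro suminf_ennreal2) (auto simp: \<mu>_def intro!: summable_mult2 summable_geometric)
  finally have "(\<integral>\<^sup>+x. (\<Sum>k. ennreal \<bar>d k x\<bar>) \<partial>M) \<noteq> \<infinity>"
    by (auto simp: top_unique)
  then have "AE x in M. (\<Sum>k. ennreal \<bar>d k x\<bar>) \<noteq> \<infinity>"
    by (intro nn_integral_PInf_AE) auto
  then have conv: "AE x in M. convergent (\<lambda>k. g (r k) x)"
  proof eventually_elim
    case (elim x)
    then have "summable (\<lambda>k. \<bar>d k x\<bar>)"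
      by (intro summable_suminf_not_top) auto
    then have "summable (\<lambda>k. d k x)"
      by (rule summable_rabs_cancel)
    then have "convergent (\<lambda>n. g (r 0) x + (\<Sum>k<n. d k x))"
      by (intro convergent_add convergent_const) (simp add: summable_iff_convergent)
    moreover have "(\<lambda>n. g (r 0) x + (\<Sum>k<n. d k x)) = (\<lambda>n. g (r n) x)"
      unfolding d_def sum_lessThan_telescope[of "\<lambda>k. g (r k) x"] by simp
    ultimately show ?case by simp
  qed
  define h where "h x = lim (\<lambda>k. g (r k) x)" for x
  have h_meas [measurable]: "h \<in> borel_measurable M"
    unfolding h_def by measurable
  have lim: "AE x in M. (\<lambda>k. g (r k) x) \<longlonglongrightarrow> h x"
    using conv by eventually_elim (simp add: h_def convergent_LIMSEQ_iff)
  have fatou: "(\<integral>\<^sup>+x. ennreal ((g n x - h x)\<^sup>2) \<partial>M) \<le> ennreal ((1/4) ^ j)" if n: "n \<ge> N j" for n j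
  proof -
    have "(\<integral>\<^sup>+x. ennreal ((g n x - h x)\<^sup>2) \<partial>M)
        = (\<integral>\<^sup>+x. liminf (\<lambda>k. ennreal ((g n x - g (r k) x)\<^sup>2)) \<partial>M)"
    proof (rule nn_integral_cong_AE)
      show "AE x in M. ennreal ((g n x - h x)\<^sup>2) = liminf (\<lambda>k. ennreal ((g n x - g (r k) x)\<^sup>2))"
        using lim
      proof eventually_elim
        case (elim x)
        then have "(\<lambda>k. ennreal ((g n x - g (r k) x)\<^sup>2)) \<longlonglongrightarrow> ennreal ((g n x - h x)\<^sup>2)"
          by (intro tendsto_intros)
        then show ?case
          by (intro lim_imp_Liminf[symmetric]) auto
      qed
    qed
    also have "\<dots> \<le> liminf (\<lambda>k. \<integral>\<^sup>+x. ennreal ((g n x - g (r k) x)\<^sup>2) \<partial>M)"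
      by (rule nn_integral_liminf) measurable
    also have "\<dots> \<le> liminf (\<lambda>k. ennreal ((1/4) ^ j))"
    proof (rule Liminf_mono)
      show "eventually (\<lambda>k. (\<integral>\<^sup>+x. ennreal ((g n x - g (r k) x)\<^sup>2) \<partial>M) \<le> ennreal ((1/4) ^ j)) sequentially"
        using eventually_ge_at_top[of j]
      proof eventually_elim
        case (elim k)
        then show ?case
          using N[OF n r_ge[OF elim]] int_diff
          by (subst nn_integral_eq_integral) (auto intro: ennreal_leI)
      qed
    qed
    also have "\<dots> = ennreal ((1/4) ^ j)"
      by (simp add: Liminf_const)
    finally show ?thesis .
  qed
  have diff_int: "integrable M (\<lambda>x. (g n x - h x)\<^sup>2)" if "n \<ge> N j" for n j
    using fatou[OF that] by (intro integrableI_bounded) (auto intro: le_less_trans)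
  have diff_le: "(LINT x|M. (g n x - h x)\<^sup>2) \<le> (1/4) ^ j" if "n \<ge> N j" for n j
    using fatou[OF that] diff_int[OF that] by (simp add: nn_integral_eq_integral)
  have "integrable M (\<lambda>x. 2 * (g (N 0) x - h x)\<^sup>2 + 2 * (g (N 0) x)\<^sup>2)"
    using diff_int[of 0 "N 0"] int by simp
  then have h_int: "integrable M (\<lambda>x. (h x)\<^sup>2)"
  proof (rule Bochner_Integration.integrable_bound)
    have "b\<^sup>2 \<le> 2 * (a - b)\<^sup>2 + 2 * a\<^sup>2" for a b :: real
      using zero_le_power2[of "2 * a - b"] by (simp add: power2_diff power_mult_distrib)
    then show "AE x in M. norm ((h x)\<^sup>2) \<le> norm (2 * (g (N 0) x - h x)\<^sup>2 + 2 * (g (N 0) x)\<^sup>2)"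
      by simp
  qed measurable
  have "(\<lambda>n. LINT x|M. (g n x - h x)\<^sup>2) \<longlonglongrightarrow> 0"
  proof (rule LIMSEQ_I)
    fix e :: real assume "e > 0"
    then obtain j where j: "(1/4) ^ j < e"
      using real_arch_pow_inv[of e "1/4"] by auto
    have "norm ((LINT x|M. (g n x - h x)\<^sup>2) - 0) < e" if "n \<ge> N j" for n
    proof -
      have "0 \<le> (LINT x|M. (g n x - h x)\<^sup>2)"
        by (intro integral_nonneg_AE) simp
      then show ?thesis
        using diff_le[OF that] j by simp
    qed
    then show "\<exists>no. \<forall>n\<ge>no. norm ((LINT x|M. (g n x - h x)\<^sup>2) - 0) < e"
      by blast
  qed
  then show ?thesis
    using that h_meas h_int by blast
qed

lemma circle_abs_integral_le:
  fixes f :: "real \<Rightarrow> real"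
  assumes [measurable]: "f \<in> borel_measurable circle" and int2: "integrable circle (\<lambda>x. (f x)\<^sup>2)"
  shows "(LINT x|circle. \<bar>f x\<bar>) \<le> sqrt (2*pi * (LINT x|circle. (f x)\<^sup>2))"
proof (rule real_le_rsqrt)
  define I where "I = (LINT x|circle. \<bar>f x\<bar>)"
  define c where "c = I / (2*pi)"
  have int: "integrable circle f"
    by (rule circle.square_integrable_imp_integrable[OF _ int2]) measurable
  have "0 \<le> (LINT x|circle. (\<bar>f x\<bar> - c)\<^sup>2)"
    by (intro integral_nonneg_AE) simp
  also have "\<dots> = (LINT x|circle. (f x)\<^sup>2 - 2 * c * \<bar>f x\<bar> + c\<^sup>2)"
    by (intro Bochner_Integration.integral_cong) (auto simp: power2_diff)
  also have "\<dots> = (LINT x|circle. (f x)\<^sup>2) - 2 * c * I + c\<^sup>2 * (2*pi)"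
    using int int2 by (simp add: I_def)
  finally have "0 \<le> 2*pi * ((LINT x|circle. (f x)\<^sup>2) - 2 * c * I + c\<^sup>2 * (2*pi))"
    by simp
  also have "\<dots> = 2*pi * (LINT x|circle. (f x)\<^sup>2) - I\<^sup>2"
    by (simp add: c_def field_simps power2_eq_square)
  finally show "(LINT x|circle. \<bar>f x\<bar>)\<^sup>2 \<le> 2*pi * (LINT x|circle. (f x)\<^sup>2)"
    by (simp add: I_def)
qed

lemma H1_norm_bounds:
  assumes "has_weak_deriv (H1_fun f) f'"
  shows "(LINT x|circle. (H1_fun f x)\<^sup>2) \<le> (norm f)\<^sup>2" "(LINT x|circle. (f' x)\<^sup>2) \<le> (norm f)\<^sup>2"
proof -
  have "0 \<le> (LINT x|circle. (H1_fun f x)\<^sup>2)" "0 \<le> (LINT x|circle. (f' x)\<^sup>2)"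
    by (intro integral_nonneg_AE; simp)+
  then show "(LINT x|circle. (H1_fun f x)\<^sup>2) \<le> (norm f)\<^sup>2" "(LINT x|circle. (f' x)\<^sup>2) \<le> (norm f)\<^sup>2"
    using norm_H1_eq[OF assms] by linarith+
qed

lemma H1_fun_0_le: "\<bar>H1_fun f 0\<bar> \<le> (sqrt (2*pi) + 1) * norm f"
proof -
  note W = has_weak_deriv_weak_deriv[of f]
  note D = has_weak_derivD[OF W]
  have le: "(LINT x|circle. \<bar>h x\<bar>) \<le> sqrt (2*pi) * norm f"
    if "h \<in> borel_measurable circle" "integrable circle (\<lambda>x. (h x)\<^sup>2)"
       "(LINT x|circle. (h x)\<^sup>2) \<le> (norm f)\<^sup>2" for h
  proof -
    have "(LINT x|circle. \<bar>h x\<bar>) \<le> sqrt (2*pi * (LINT x|circle. (h x)\<^sup>2))"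
      using that by (intro circle_abs_integral_le)
    also have "\<dots> \<le> sqrt (2*pi * (norm f)\<^sup>2)"
      using that(3) by (intro real_sqrt_le_mono mult_left_mono) auto
    finally show ?thesis by (simp add: real_sqrt_mult)
  qed
  have f_le: "(LINT x|circle. \<bar>H1_fun f x\<bar>) \<le> sqrt (2*pi) * norm f"
    using has_weak_deriv_measurable[OF W] has_weak_deriv_square_integrable[OF W] H1_norm_bounds(1)[OF W]
    by (rule le)
  have g_le: "(LINT x|circle. \<bar>weak_deriv f x\<bar>) \<le> sqrt (2*pi) * norm f"
    using D(2,3) H1_norm_bounds(2)[OF W] by (rule le)
  have f_int: "integrable circle (H1_fun f)"
    by (rule circle.square_integrable_imp_integrable[OF has_weak_deriv_measurable[OF W]
          has_weak_deriv_square_integrable[OF W]])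
  have "(LINT x|circle. \<bar>H1_fun f 0\<bar>)
      \<le> (LINT x|circle. \<bar>H1_fun f x\<bar> + (LINT t|circle. \<bar>weak_deriv f t\<bar>))"
  proof (rule integral_mono)
    fix x assume "x \<in> space circle"
    then show "\<bar>H1_fun f 0\<bar> \<le> \<bar>H1_fun f x\<bar> + (LINT t|circle. \<bar>weak_deriv f t\<bar>)"
      using has_weak_deriv_bound[OF W, of x] by simp
  qed (use f_int in auto)
  also have "\<dots> = (LINT x|circle. \<bar>H1_fun f x\<bar>) + 2*pi * (LINT t|circle. \<bar>weak_deriv f t\<bar>)"
    using f_int by simp
  also have "\<dots> \<le> sqrt (2*pi) * norm f + 2*pi * (sqrt (2*pi) * norm f)"
    using f_le g_le by (intro add_mono mult_left_mono) auto
  finally have *: "2*pi * \<bar>H1_fun f 0\<bar> \<le> sqrt (2*pi) * norm f + 2*pi * (sqrt (2*pi) * norm f)"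
    by simp
  have "sqrt (2*pi) * 1 \<le> sqrt (2*pi) * sqrt (2*pi)"
    using pi_ge_two by (intro mult_left_mono) auto
  then have "sqrt (2*pi) * norm f \<le> 2*pi * norm f"
    by (intro mult_right_mono) auto
  with * have "2*pi * \<bar>H1_fun f 0\<bar> \<le> 2*pi * norm f + 2*pi * (sqrt (2*pi) * norm f)"
    by linarith
  also have "\<dots> = 2*pi * ((sqrt (2*pi) + 1) * norm f)"
    by (simp only: distrib_left distrib_right mult_1_left add.commute)
  finally show ?thesis
    by (rule mult_left_le_imp_le) simp
qed

instance H1 :: banach
proof
  fix X :: "nat \<Rightarrow> H1"
  assume X: "Cauchy X"
  note W = has_weak_deriv_weak_deriv
  note D = has_weak_derivD[OF W]
  have diff: "has_weak_deriv (H1_fun (F - G)) (\<lambda>x. weak_deriv F x - weak_deriv G x)" for F G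
    by (simp add: minus_H1.rep_eq has_weak_deriv_diff W)
  obtain g where g [measurable]: "g \<in> borel_measurable circle"
    and g2: "integrable circle (\<lambda>x. (g x)\<^sup>2)"
    and lim_g: "(\<lambda>n. LINT x|circle. (weak_deriv (X n) x - g x)\<^sup>2) \<longlonglongrightarrow> 0"
  proof (rule circle.L2_complete[of "\<lambda>n. weak_deriv (X n)"])
    fix e :: real assume e: "e > 0"
    then obtain N where N: "\<And>m n. m \<ge> N \<Longrightarrow> n \<ge> N \<Longrightarrow> norm (X m - X n) < sqrt e"
      using CauchyD[OF X, of "sqrt e"] by auto
    have "(LINT x|circle. (weak_deriv (X m) x - weak_deriv (X n) x)\<^sup>2) < e"
      if "m \<ge> N" "n \<ge> N" for m n
    proof -
      have "(LINT x|circle. (weak_deriv (X m) x - weak_deriv (X n) x)\<^sup>2) \<le> (norm (X m - X n))\<^sup>2"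
        by (rule H1_norm_bounds(2)[OF diff])
      also have "\<dots> < (sqrt e)\<^sup>2"
        using N[OF that] by (intro power_strict_mono) auto
      finally show ?thesis using e by simp
    qed
    then show "\<exists>N. \<forall>m\<ge>N. \<forall>n\<ge>N. (LINT x|circle. (weak_deriv (X m) x - weak_deriv (X n) x)\<^sup>2) < e"
      by blast
  qed (use D in auto)
  have g1: "integrable circle g"
    by (rule circle.square_integrable_imp_integrable[OF g g2])
  have diff_g1: "integrable circle (\<lambda>x. weak_deriv (X n) x - g x)" for n
    using g1 D(4) by simp
  have diff_g2: "integrable circle (\<lambda>x. (weak_deriv (X n) x - g x)\<^sup>2)" for n
    using g2 D(2,3) integrable_prod_square[of "weak_deriv (X n)" circle g]
    by (simp add: power2_diff mult.assoc)
  define \<gamma> where "\<gamma> n = (LINT x|circle. \<bar>weak_deriv (X n) x - g x\<bar>)" for n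
  have lim_\<gamma>: "\<gamma> \<longlonglongrightarrow> 0"
  proof (rule real_tendsto_sandwich[of "\<lambda>_. 0"])
    show "eventually (\<lambda>n. 0 \<le> \<gamma> n) sequentially"
      unfolding \<gamma>_def by (intro always_eventually allI integral_nonneg_AE) simp
    show "eventually (\<lambda>n. \<gamma> n \<le> sqrt (2*pi * (LINT x|circle. (weak_deriv (X n) x - g x)\<^sup>2))) sequentially"
      unfolding \<gamma>_def
      by (intro always_eventually allI circle_abs_integral_le diff_g2 borel_measurable_diff D(2) g)
    show "(\<lambda>n. sqrt (2*pi * (LINT x|circle. (weak_deriv (X n) x - g x)\<^sup>2))) \<longlonglongrightarrow> 0"
      using tendsto_real_sqrt[OF tendsto_mult[OF tendsto_const[of "2*pi"] lim_g]] by simp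
  qed auto
  have "Cauchy (\<lambda>n. H1_fun (X n) 0)"
  proof (rule CauchyI)
    fix e :: real assume e: "e > 0"
    define C where "C = sqrt (2*pi) + 1"
    have C: "C > 0" by (simp add: C_def add_nonneg_pos)
    then obtain N where N: "\<And>m n. m \<ge> N \<Longrightarrow> n \<ge> N \<Longrightarrow> norm (X m - X n) < e / C"
      using CauchyD[OF X, of "e / C"] e by auto
    have "norm (H1_fun (X m) 0 - H1_fun (X n) 0) < e" if "m \<ge> N" "n \<ge> N" for m n
    proof -
      have "norm (H1_fun (X m) 0 - H1_fun (X n) 0) \<le> C * norm (X m - X n)"
        using H1_fun_0_le[of "X m - X n"] by (simp add: minus_H1.rep_eq C_def)
      also have "\<dots> < e"
        using N[OF that] C by (simp add: pos_less_divide_eq mult.commute)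
      finally show ?thesis .
    qed
    then show "\<exists>M. \<forall>m\<ge>M. \<forall>n\<ge>M. norm (H1_fun (X m) 0 - H1_fun (X n) 0) < e"
      by blast
  qed
  then obtain c where c: "(\<lambda>n. H1_fun (X n) 0) \<longlonglongrightarrow> c"
    using Cauchy_convergent_iff convergent_def by blast
  define h where "h x = c + (LINT t|circle. indicator {0..x} t * g t)" for x
  have bound: "\<bar>H1_fun (X n) x - h x\<bar> \<le> \<bar>H1_fun (X n) 0 - c\<bar> + \<gamma> n" if x: "x \<in> {0..2*pi}" for n x
  proof -
    have "H1_fun (X n) x - h x
        = H1_fun (X n) 0 - c + (LINT t|circle. indicator {0..x} t * (weak_deriv (X n) t - g t))"
      using D(4) D(5)[OF x] g1 by (simp add: h_def right_diff_distrib integrable_ind)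
    moreover have "\<bar>LINT t|circle. indicator {0..x} t * (weak_deriv (X n) t - g t)\<bar> \<le> \<gamma> n"
    proof -
      have "\<bar>LINT t|circle. indicator {0..x} t * (weak_deriv (X n) t - g t)\<bar>
          \<le> (LINT t|circle. \<bar>indicator {0..x} t * (weak_deriv (X n) t - g t)\<bar>)"
        using integral_norm_bound[of circle "\<lambda>t. indicator {0..x} t * (weak_deriv (X n) t - g t)"]
        by simp
      also have "\<dots> \<le> \<gamma> n"
        unfolding \<gamma>_def using diff_g1
        by (intro integral_mono integrable_abs integrable_ind) (auto simp: indicator_def)
      finally show ?thesis .
    qed
    ultimately show ?thesis by linarith
  qed
  have lim_b: "(\<lambda>n. \<bar>H1_fun (X n) 0 - c\<bar> + \<gamma> n) \<longlonglongrightarrow> 0"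
    using tendsto_add[OF tendsto_rabs[OF LIM_zero[OF c]] lim_\<gamma>] by simp
  have lim_h: "(\<lambda>n. H1_fun (X n) x) \<longlonglongrightarrow> h x" if x: "x \<in> {0..2*pi}" for x
  proof (rule LIM_zero_cancel, rule Lim_null_comparison[OF _ lim_b])
    show "eventually (\<lambda>n. norm (H1_fun (X n) x - h x) \<le> \<bar>H1_fun (X n) 0 - c\<bar> + \<gamma> n) sequentially"
      using bound[OF x] by simp
  qed
  have h_per: "h (2*pi) = h 0"
  proof (rule LIMSEQ_unique)
    show "(\<lambda>n. H1_fun (X n) 0) \<longlonglongrightarrow> h 0"
      by (rule lim_h) simp
    show "(\<lambda>n. H1_fun (X n) 0) \<longlonglongrightarrow> h (2*pi)"
      using lim_h[of "2*pi"] D(1)[of _ 0] by simp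
  qed
  define H where "H x = h (x - 2*pi * of_int \<lfloor>x / (2*pi)\<rfloor>)" for x
  have H_eq: "H x = h x" if x: "x \<in> {0..2*pi}" for x
  proof (cases "x = 2*pi")
    case True
    then show ?thesis by (simp add: H_def h_per)
  next
    case False
    then have "\<lfloor>x / (2*pi)\<rfloor> = 0"
      using x by (intro floor_unique) (auto simp: pos_divide_less_eq)
    then show ?thesis by (simp add: H_def)
  qed
  have "has_weak_deriv H g"
  proof (rule has_weak_derivI)
    show "H (x + 2*pi) = H x" for x
      by (simp add: H_def add_divide_distrib algebra_simps)
    have "(LINT t|circle. indicator {0..0} t * g t) = 0"
      by (rule integral_eq_zero_AE)
         (use AE_circle_neq[of 0] in \<open>eventually_elim, auto simp: indicator_def\<close>)
    then have "h 0 = c"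
      by (simp add: h_def)
    then show "H x = H 0 + (LINT t|circle. indicator {0..x} t * g t)" if "x \<in> {0..2*pi}" for x
      using H_eq[OF that] H_eq[of 0] by (simp add: h_def)
  qed (use g g2 in auto)
  then have HF: "H1_fun (Abs_H1 H) = H"
    by (intro Abs_H1_inverse) auto
  have "X \<longlonglongrightarrow> Abs_H1 H"
  proof (rule LIM_zero_cancel, rule tendsto_norm_zero_cancel)
    have wd: "has_weak_deriv (H1_fun (X n - Abs_H1 H)) (\<lambda>x. weak_deriv (X n) x - g x)" for n
      using has_weak_deriv_diff[OF W \<open>has_weak_deriv H g\<close>] by (simp add: minus_H1.rep_eq HF)
    have le: "(norm (X n - Abs_H1 H))\<^sup>2
        \<le> 2*pi * (\<bar>H1_fun (X n) 0 - c\<bar> + \<gamma> n)\<^sup>2 + (LINT x|circle. (weak_deriv (X n) x - g x)\<^sup>2)" for n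
    proof -
      have "(LINT x|circle. (H1_fun (X n - Abs_H1 H) x)\<^sup>2)
          \<le> (LINT x|circle. (\<bar>H1_fun (X n) 0 - c\<bar> + \<gamma> n)\<^sup>2)"
      proof (rule integral_mono)
        fix x assume "x \<in> space circle"
        then have "\<bar>H1_fun (X n - Abs_H1 H) x\<bar> \<le> \<bar>H1_fun (X n) 0 - c\<bar> + \<gamma> n"
          using bound[of x n] H_eq[of x] by (simp add: minus_H1.rep_eq HF)
        then show "(H1_fun (X n - Abs_H1 H) x)\<^sup>2 \<le> (\<bar>H1_fun (X n) 0 - c\<bar> + \<gamma> n)\<^sup>2"
          using power_mono[of "\<bar>H1_fun (X n - Abs_H1 H) x\<bar>" _ 2] by simp
      qed (use has_weak_deriv_square_integrable[OF wd] in auto)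
      then show ?thesis
        using norm_H1_eq[OF wd, of n] by simp
    qed
    have "(\<lambda>n. 2*pi * (\<bar>H1_fun (X n) 0 - c\<bar> + \<gamma> n)\<^sup>2
        + (LINT x|circle. (weak_deriv (X n) x - g x)\<^sup>2)) \<longlonglongrightarrow> 2*pi * 0\<^sup>2 + 0"
      by (intro tendsto_intros lim_b lim_g)
    then have lim: "(\<lambda>n. 2*pi * (\<bar>H1_fun (X n) 0 - c\<bar> + \<gamma> n)\<^sup>2
        + (LINT x|circle. (weak_deriv (X n) x - g x)\<^sup>2)) \<longlonglongrightarrow> 0"
      by simp
    have "(\<lambda>n. (norm (X n - Abs_H1 H))\<^sup>2) \<longlonglongrightarrow> 0"
    proof (rule real_tendsto_sandwich[OF _ _ tendsto_const lim])
      show "eventually (\<lambda>n. 0 \<le> (norm (X n - Abs_H1 H))\<^sup>2) sequentially"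
        by simp
    qed (intro always_eventually allI le)
    from tendsto_real_sqrt[OF this] show "(\<lambda>n. norm (X n - Abs_H1 H)) \<longlonglongrightarrow> 0"
      by simp
  qed
  then show "convergent X"
    by (rule convergentI)
qed


section \<open>The formal expansion of the traveling waves\<close>

text \<open>
  Here \<open>bh_u n k\<close> is the coefficient of \<open>cos (k x)\<close> at order \<open>n\<close> and \<open>bh_v n\<close> the speed
  coefficient. The recurrence is solved for its leading unknown; it only ever refers to
  \<open>bh_u n k\<close> with \<open>1 \<le> k \<le> n\<close>, the value being \<open>0\<close> elsewhere. Truncated
  subtraction in the summation bounds is harmless: \<open>k + m - n\<close> is compared with \<open>1\<close>, and
  \<open>n - m - k = 0\<close> gives the empty range when the true difference is negative. The lemmas
  below state the recurrence in its original form.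
\<close>

function bh_u :: "nat \<Rightarrow> nat \<Rightarrow> real" and bh_v :: "nat \<Rightarrow> real" where
  "bh_u n k =
     (if n = 1 \<and> k = 1 then 1
      else if k < 2 \<or> n < k \<or> odd (n - k) then 0
      else (real k * (\<Sum>m=1..n-k. bh_v m * bh_u (n - m) k)
            - real k / 4 * (\<Sum>m=1..n-1. \<Sum>l=max 1 (k+m-n)..min m (k-1). bh_u m l * bh_u (n - m) (k - l))
            - real k / 2 * (\<Sum>m=1..n-1. \<Sum>l=1..min m (n-m-k). bh_u m l * bh_u (n - m) (k + l)))
           / (real k - 1))"
| "bh_v n =
     (if n = 0 then -1
      else 1/2 * (\<Sum>m=1..n. \<Sum>l=1..min m (n-m). bh_u m l * bh_u (n + 1 - m) (1 + l)))"
  by pat_completeness auto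
termination
  by (relation "Wellfounded.measure (\<lambda>x. case x of Inl (n, k) \<Rightarrow> 2 * n | Inr n \<Rightarrow> 2 * n + 1)") auto

declare bh_u.simps [simp del] bh_v.simps [simp del]

lemma bh_u_1: "bh_u n 1 = (if n = 1 then 1 else 0)"
  by (subst bh_u.simps) simp

lemma bh_u_odd: "k \<le> n \<Longrightarrow> odd (n - k) \<Longrightarrow> bh_u n k = 0"
  by (subst bh_u.simps) auto

lemma bh_v_0: "bh_v 0 = -1"
  by (subst bh_v.simps) simp

lemma bh_v_rec:
  assumes "n \<ge> 2"
  shows "bh_v (n - 1) =
    1/2 * (\<Sum>m=1..n-1. \<Sum>l=1..min m (n-m-1). bh_u m l * bh_u (n - m) (1 + l))"
  using assms by (subst bh_v.simps) (auto simp: diff_right_commute intro!: sum.cong)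

lemma bh_u_rec:
  assumes "2 \<le> k" "k \<le> n" "even (n - k)"
  shows "(1 - real k) * bh_u n k
    + real k * (\<Sum>m=1..n-k. bh_v m * bh_u (n - m) k)
    - real k / 4 * (\<Sum>m=1..n-1. \<Sum>l=max 1 (k+m-n)..min m (k-1). bh_u m l * bh_u (n - m) (k - l))
    - real k / 2 * (\<Sum>m=1..n-1. \<Sum>l=1..min m (n-m-k). bh_u m l * bh_u (n - m) (k + l)) = 0"
proof -
  define S where "S = real k * (\<Sum>m=1..n-k. bh_v m * bh_u (n - m) k)
    - real k / 4 * (\<Sum>m=1..n-1. \<Sum>l=max 1 (k+m-n)..min m (k-1). bh_u m l * bh_u (n - m) (k - l))
    - real k / 2 * (\<Sum>m=1..n-1. \<Sum>l=1..min m (n-m-k). bh_u m l * bh_u (n - m) (k + l))"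
  have "bh_u n k = S / (real k - 1)"
    using assms unfolding S_def by (subst bh_u.simps) simp
  then have "(1 - real k) * bh_u n k + S = 0"
    using assms by (simp add: field_simps)
  then show ?thesis
    by (simp add: S_def algebra_simps)
qed

lift_definition bh_profile :: "nat \<Rightarrow> H1" is
  "\<lambda>n x. if n = 1 then cos x else \<Sum>k=2..n. bh_u n k * cos (real k * x)"
proof
  fix n :: nat
  show "has_weak_deriv (\<lambda>x. if n = 1 then cos x else \<Sum>k=2..n. bh_u n k * cos (real k * x))
          (\<lambda>x. if n = 1 then - sin x else \<Sum>k=2..n. bh_u n k * (- sin (real k * x) * real k))"
  proof (rule has_weak_deriv_C1)
    have "cos (real k * (x + 2*pi)) = cos (real k * x)" for k x
    proof -
      have "cos (real k * (x + 2*pi)) = cos (real k * x + 2 * real k * pi)"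
        by (simp add: algebra_simps)
      then show ?thesis
        by (simp only: cos_add cos_2npi sin_2npi mult_1_right mult_zero_right diff_zero)
    qed
    then show "(if n = 1 then cos (x + 2*pi) else \<Sum>k=2..n. bh_u n k * cos (real k * (x + 2*pi)))
        = (if n = 1 then cos x else \<Sum>k=2..n. bh_u n k * cos (real k * x))" for x
      by simp
    show "((\<lambda>x. if n = 1 then cos x else \<Sum>k=2..n. bh_u n k * cos (real k * x)) has_real_derivative
        (if n = 1 then - sin x else \<Sum>k=2..n. bh_u n k * (- sin (real k * x) * real k))) (at x)" for x
      by (cases "n = 1") (auto intro!: derivative_eq_intros sum.cong)
    show "continuous_on UNIV
        (\<lambda>x. if n = 1 then - sin x else \<Sum>k=2..n. bh_u n k * (- sin (real k * x) * real k))"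
      by (cases "n = 1") (auto intro!: continuous_intros)
  qed
qed

end

theory Submission
  imports Defs
begin

text \<open>
  The diagonal coefficients \<open>a\<^sub>n = u\<^sub>n\<^sub>,\<^sub>n\<close> decouple from the rest of the recurrence:
  \<open>(1 - n) a\<^sub>n = n/4 \<Sum> a\<^sub>m a\<^sub>n\<^sub>-\<^sub>m\<close>. So \<open>A(z) = \<Sum> a\<^sub>n z\<^sup>n = z B(z)\<close> satisfies
  \<open>A = z A' (1 + A/2)\<close>, i.e. \<open>A exp (A/2) = z\<close> (thus \<open>A = 2 W(z/2)\<close> for the Lambert
  function \<open>W\<close>). If the series converged beyond \<open>2/e\<close>, then at \<open>z = -2/e\<close> the equation
  \<open>(A/2) exp (A/2) = -1/e\<close> would force \<open>A = -2\<close>, while the differential equation then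
  gives \<open>A = 0\<close>. As \<open>a\<^sub>n\<close> is a Fourier coefficient of the \<open>n\<close>-th profile, it is
  dominated by its \<open>H\<^sup>1\<close> norm.
\<close>

section \<open>Radius of convergence and the Lambert equation\<close>

lemma conv_radius_mono:
  fixes f :: "nat \<Rightarrow> 'a::banach" and g :: "nat \<Rightarrow> 'b::banach"
  assumes "eventually (\<lambda>n. norm (g n) \<le> norm (f n)) sequentially"
  shows "conv_radius f \<le> conv_radius g"
  unfolding conv_radius_altdef
proof (rule Liminf_mono)
  show "eventually (\<lambda>n. inverse (ereal (root n (norm (f n))))
      \<le> inverse (ereal (root n (norm (g n))))) sequentially"
    using assms eventually_gt_at_top[of 0]
    by eventually_elim (intro ereal_inverse_antimono, auto simp: real_root_ge_zero)
qed

text \<open>The value -1/e is the minimum of w exp w. Multiplying by exp (-w) turns the hypothesis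
  into equality in exp (-t) >= 1 - t with t = w + 1, which is strict unless t = 0.\<close>

lemma x_exp_eq_minus_exp_minus_one:
  fixes w :: real
  assumes "w * exp w = - exp (-1)"
  shows "w = -1"
proof -
  have "exp (- (w + 1)) = exp (-1) * exp (- w)"
    by (simp flip: exp_add)
  also have "\<dots> = - (w * exp w) * exp (- w)"
    using assms by simp
  also have "\<dots> = 1 - (w + 1)"
    by (simp add: exp_minus)
  finally have "exp (- (w + 1)) = 1 - (w + 1)" .
  then show ?thesis
    using exp_minus_greater[of "w + 1"] by auto
qed

text \<open>The equation is A = z A' (1 + A/2) after substituting A = z B and cancelling z^2/2,
  which removes the singularity at 0.\<close>

lemma Lambert_ode_conv_radius:
  fixes B :: "real fps"
  assumes B0: "fps_nth B 0 = 1"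
    and ode: "2 * fps_deriv B + fps_X * B * fps_deriv B + B * B = 0"
  shows "fps_conv_radius B \<le> ereal (2 / exp 1)"
proof (rule ccontr)
  assume "\<not> ?thesis"
  then have less: "ereal (2 / exp 1) < fps_conv_radius B"
    by simp
  define b b' where "b = eval_fps B" and "b' = eval_fps (fps_deriv B)"
  \<comment> \<open>The strict inequality for the radius puts the endpoint -2/e inside the disc of
    convergence.\<close>
  have conv: "ereal (norm z) < fps_conv_radius B" if "z \<in> {- (2 / exp 1)..0}" for z :: real
    by (rule le_less_trans[OF _ less]) (use that in auto)
  have ode_eval: "2 * b' z + z * b z * b' z + b z * b z = 0" if "z \<in> {- (2 / exp 1)..0}" for z
  proof -
    note c = conv[OF that]
    have c': "ereal (norm z) < fps_conv_radius (fps_deriv B)"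
      using c fps_conv_radius_deriv[of B] by (rule less_le_trans)
    have mult: "ereal (norm z) < fps_conv_radius (F * G)"
      if "ereal (norm z) < fps_conv_radius F" "ereal (norm z) < fps_conv_radius G" for F G :: "real fps"
      by (rule less_le_trans[OF _ fps_conv_radius_mult]) (use that in simp)
    have add: "ereal (norm z) < fps_conv_radius (F + G)"
      if "ereal (norm z) < fps_conv_radius F" "ereal (norm z) < fps_conv_radius G" for F G :: "real fps"
      by (rule less_le_trans[OF _ fps_conv_radius_add]) (use that in simp)
    have X: "ereal (norm z) < fps_conv_radius fps_X" "ereal (norm z) < fps_conv_radius 2"
      by auto
    have "eval_fps (2 * fps_deriv B + fps_X * B * fps_deriv B + B * B) z
        = 2 * b' z + z * b z * b' z + b z * b z"
      unfolding b_def b'_def by (simp add: eval_fps_add eval_fps_mult add mult c c' X del: real_norm_def)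
    then show ?thesis
      by (simp add: ode)
  qed
  \<comment> \<open>This is A exp (A/2) / z, a first integral: its derivative is exp (z b/2) / 2
    times the left-hand side of the equation. Its value at 0 is 1.\<close>
  have "\<exists>C. \<forall>z\<in>{- (2 / exp 1)..0}. b z * exp (z * b z / 2) = C"
  proof (rule has_field_derivative_zero_constant)
    fix z :: real assume z: "z \<in> {- (2 / exp 1)..0}"
    have "(b has_field_derivative b' z) (at z within {- (2 / exp 1)..0})"
      unfolding b_def b'_def by (rule has_field_derivative_eval_fps) (rule conv[OF z])
    then have "((\<lambda>z. b z * exp (z * b z / 2)) has_field_derivative
        b' z * exp (z * b z / 2) + b z * (exp (z * b z / 2) * ((b z + z * b' z) / 2)))
        (at z within {- (2 / exp 1)..0})"
      by (auto intro!: derivative_eq_intros simp: algebra_simps)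
    also have "b' z * exp (z * b z / 2) + b z * (exp (z * b z / 2) * ((b z + z * b' z) / 2))
        = exp (z * b z / 2) / 2 * (2 * b' z + z * b z * b' z + b z * b z)"
      by (simp add: algebra_simps)
    finally show "((\<lambda>z. b z * exp (z * b z / 2)) has_field_derivative 0)
        (at z within {- (2 / exp 1)..0})"
      by (simp add: ode_eval[OF z])
  qed auto
  then obtain C where C: "\<And>z. z \<in> {- (2 / exp 1)..0} \<Longrightarrow> b z * exp (z * b z / 2) = C"
    by blast
  have "C = 1"
    using C[of 0] by (simp add: b_def eval_fps_at_0 B0)
  define z :: real where "z = - (2 / exp 1)"
  have z: "z \<in> {- (2 / exp 1)..0}"
    by (simp add: z_def)
  \<comment> \<open>Here w is A/2 at z = -2/e, so w exp w = z/2 = -1/e.\<close>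
  define w where "w = z * b z / 2"
  have "w * exp w = z / 2 * (b z * exp (z * b z / 2))"
    by (simp add: w_def)
  also have "\<dots> = - exp (-1)"
    unfolding C[OF z] \<open>C = 1\<close> by (simp add: z_def exp_minus field_simps)
  finally have "w = -1"
    by (rule x_exp_eq_minus_exp_minus_one)
  then have "z * b z = -2"
    by (simp add: w_def)
  \<comment> \<open>The coefficient 2 + z b of b' vanishes at this point, which leaves b^2 =
    0.\<close>
  with ode_eval[OF z] have "b z = 0"
    by simp
  with \<open>z * b z = -2\<close> show False
    by simp
qed

section \<open>The diagonal coefficients and their generating series\<close>

lemma bh_u_0 [simp]: "bh_u n 0 = 0"
  by (subst bh_u.simps) simp

text \<open>For k = n the speed sum and the last sum are empty, and the range of l in the middle sum
  shrinks to l = m. The terms m = 0 and m = n vanish because \<open>bh_u 0 0 = 0\<close>; including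
  them makes the sum a Cauchy product coefficient.\<close>

lemma bh_u_diag:
  "(1 - real n) * bh_u n n = real n / 4 * (\<Sum>m=0..n. bh_u m m * bh_u (n - m) (n - m))"
proof (cases "2 \<le> n")
  case True
  have "(\<Sum>l=max 1 (n+m-n)..min m (n-1). bh_u m l * bh_u (n - m) (n - l))
      = bh_u m m * bh_u (n - m) (n - m)" if "m \<in> {1..n-1}" for m
  proof -
    have "{max 1 (n+m-n)..min m (n-1)} = {m}"
      using that by auto
    then show ?thesis by simp
  qed
  then have "(1 - real n) * bh_u n n
      = real n / 4 * (\<Sum>m=1..n-1. bh_u m m * bh_u (n - m) (n - m))"
    using bh_u_rec[of n n] True by simp
  also have "(\<Sum>m=1..n-1. bh_u m m * bh_u (n - m) (n - m))
      = (\<Sum>m=0..n. bh_u m m * bh_u (n - m) (n - m))"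
  proof (rule sum.mono_neutral_left)
    show "\<forall>m\<in>{0..n} - {1..n-1}. bh_u m m * bh_u (n - m) (n - m) = 0"
    proof
      fix m assume "m \<in> {0..n} - {1..n-1}"
      then have "m = 0 \<or> n - m = 0" by auto
      then show "bh_u m m * bh_u (n - m) (n - m) = 0" by auto
    qed
  qed auto
  finally show ?thesis .
next
  case False
  then consider "n = 0" | "n = 1" by linarith
  then show ?thesis by cases auto
qed

lemma conv_radius_bh_u_diag: "conv_radius (\<lambda>n. bh_u n n) \<le> ereal (2 / exp 1)"
proof -
  define A where "A = Abs_fps (\<lambda>n. bh_u n n)"
  define B where "B = fps_shift 1 A"
  have A: "A = fps_X * B"
  proof (rule fps_ext)
    show "fps_nth A n = fps_nth (fps_X * B) n" for n
      by (cases n) (simp_all add: A_def B_def)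
  qed
  \<comment> \<open>\<open>bh_u_diag\<close> times 4, read coefficientwise: X d/dX multiplies the
    n-th coefficient by n.\<close>
  have A_ode: "4 * A - 4 * (fps_X * fps_deriv A) = fps_X * fps_deriv (A * A)"
  proof (rule fps_ext)
    fix n
    have X_deriv: "fps_nth (fps_X * fps_deriv F) n = real n * fps_nth F n" for F :: "real fps"
      by (cases n) simp_all
    have "fps_nth (4 * A - 4 * (fps_X * fps_deriv A)) n = 4 * ((1 - real n) * bh_u n n)"
      by (simp add: numeral_fps_const X_deriv A_def algebra_simps)
    also have "\<dots> = real n * fps_nth (A * A) n"
      unfolding bh_u_diag by (simp add: fps_mult_nth A_def)
    finally show "fps_nth (4 * A - 4 * (fps_X * fps_deriv A)) n = fps_nth (fps_X * fps_deriv (A * A)) n"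
      by (simp only: X_deriv)
  qed
  have "fps_deriv A = B + fps_X * fps_deriv B"
    by (simp add: A)
  then have "2 * fps_X\<^sup>2 * (2 * fps_deriv B + fps_X * B * fps_deriv B + B * B)
      = fps_X * fps_deriv (A * A) - (4 * A - 4 * (fps_X * fps_deriv A))"
    by (simp add: A algebra_simps power2_eq_square)
  also have "\<dots> = 0"
    by (simp only: A_ode diff_self)
  finally have "2 * fps_X\<^sup>2 * (2 * fps_deriv B + fps_X * B * fps_deriv B + B * B) = 0" .
  \<comment> \<open>The factor 2 X^2 cancels since formal power series over a field form an integral
    domain.\<close>
  then have "2 * fps_deriv B + fps_X * B * fps_deriv B + B * B = 0"
    by simp
  moreover have "fps_nth B 0 = 1"
    using bh_u_1[of 1] by (simp add: A_def B_def)
  ultimately have "fps_conv_radius B \<le> ereal (2 / exp 1)"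
    by (intro Lambert_ode_conv_radius)
  then have "fps_conv_radius A \<le> ereal (2 / exp 1)"
    by (simp only: B_def fps_conv_radius_shift)
  then show ?thesis
    by (simp add: A_def fps_conv_radius_def)
qed

section \<open>Orthogonality of cosines and the Fourier coefficient bound\<close>

lemma has_weak_deriv_sin_int:
  fixes j :: int
  shows "has_weak_deriv (\<lambda>x. sin (of_int j * x)) (\<lambda>x. of_int j * cos (of_int j * x))"
proof (rule has_weak_deriv_C1)
  show "sin (of_int j * (x + 2*pi)) = sin (of_int j * x)" for x
  proof -
    have "sin (of_int j * (x + 2*pi)) = sin (of_int j * x + 2 * pi * of_int j)"
      by (simp add: algebra_simps)
    then show ?thesis
      by (simp only: sin_add sin_int_2pin cos_int_2pin mult_1_right mult_zero_right add_0_right)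
  qed
qed (auto intro!: derivative_eq_intros continuous_intros)

lemma integrable_circle_cos: "integrable circle (\<lambda>x. cos (c * x))"
  by (rule circle.integrable_const_bound[of _ 1])
     (auto intro!: borel_measurable_circleI borel_measurable_continuous_onI continuous_intros)

text \<open>The primitive sin (j x) takes equal values at 0 and 2 pi. Integer frequencies are used
  because the product-to-sum formula produces k - n, which may be negative.\<close>

lemma integral_circle_cos_int:
  fixes j :: int
  assumes "j \<noteq> 0"
  shows "(LINT x|circle. cos (of_int j * x)) = 0"
proof -
  have "(LINT x|circle. of_int j * cos (of_int j * x))
      = (LINT x|circle. indicator {0..2*pi} x * (of_int j * cos (of_int j * x)))"
    by (intro Bochner_Integration.integral_cong) auto
  also have "\<dots> = sin (of_int j * (2*pi)) - sin (of_int j * 0)"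
    using has_weak_derivD(5)[OF has_weak_deriv_sin_int, of "2*pi" j] by simp
  also have "\<dots> = 0"
    using sin_int_2pin[of j] by (simp add: mult_ac)
  finally show ?thesis
    using assms by simp
qed

lemma integral_circle_cos_cos:
  fixes k n :: nat
  assumes "n > 0"
  shows "integrable circle (\<lambda>x. cos (real k * x) * cos (real n * x))"
    and "(LINT x|circle. cos (real k * x) * cos (real n * x)) = (if k = n then pi else 0)"
proof -
  have eq: "cos (real k * x) * cos (real n * x)
      = (cos (of_int (int k - int n) * x) + cos (of_int (int k + int n) * x)) / 2" for x
    by (simp add: cos_times_cos algebra_simps)
  show "integrable circle (\<lambda>x. cos (real k * x) * cos (real n * x))"
    unfolding eq using integrable_circle_cos by simp
  have "(LINT x|circle. cos (real k * x) * cos (real n * x))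
      = ((LINT x|circle. cos (of_int (int k - int n) * x))
        + (LINT x|circle. cos (of_int (int k + int n) * x))) / 2"
    unfolding eq using integrable_circle_cos by simp
  \<comment> \<open>As n > 0, the sum frequency is nonzero; only the difference frequency can
    contribute.\<close>
  also have "(LINT x|circle. cos (of_int (int k + int n) * x)) = 0"
    using assms by (intro integral_circle_cos_int) simp
  also have "(LINT x|circle. cos (of_int (int k - int n) * x)) = (if k = n then 2*pi else 0)"
  proof (cases "k = n")
    case False
    then show ?thesis
      using integral_circle_cos_int[of "int k - int n"] by simp
  qed simp
  finally show "(LINT x|circle. cos (real k * x) * cos (real n * x)) = (if k = n then pi else 0)"
    by (cases "k = n") simp_all
qed

text \<open>Pairing the profile with cos (n x) isolates pi times its top coefficient; the pairing is
  at most the L1 norm, which Cauchy-Schwarz bounds by the L2 norm and hence by the \<open>H1\<close>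
  norm.\<close>

lemma bh_u_diag_le_norm:
  assumes "n \<ge> 2"
  shows "\<bar>bh_u n n\<bar> \<le> norm (bh_profile n)"
proof -
  define f where "f = H1_fun (bh_profile n)"
  note W = has_weak_deriv_weak_deriv[of "bh_profile n", folded f_def]
  note meas = has_weak_deriv_measurable[OF W]
  note int2 = has_weak_deriv_square_integrable[OF W]
  note int = circle.square_integrable_imp_integrable[OF meas int2]
  have f: "f x * cos (real n * x) = (\<Sum>k=2..n. bh_u n k * (cos (real k * x) * cos (real n * x)))" for x
    using assms by (simp add: f_def bh_profile.rep_eq sum_distrib_right mult.assoc)
  have "(LINT x|circle. f x * cos (real n * x)) = (\<Sum>k=2..n. bh_u n k * (if k = n then pi else 0))"
    unfolding f using assms
    by (subst Bochner_Integration.integral_sum) (simp_all add: integral_circle_cos_cos)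
  also have "\<dots> = (\<Sum>k=2..n. if k = n then bh_u n k * pi else 0)"
    by (intro sum.cong) auto
  also have "\<dots> = pi * bh_u n n"
    using assms by simp
  finally have "pi * \<bar>bh_u n n\<bar> = \<bar>LINT x|circle. f x * cos (real n * x)\<bar>"
    by (simp add: abs_mult)
  also have "\<dots> \<le> (LINT x|circle. \<bar>f x * cos (real n * x)\<bar>)"
    using integral_norm_bound[of circle "\<lambda>x. f x * cos (real n * x)"] by simp
  also have "\<dots> \<le> (LINT x|circle. \<bar>f x\<bar>)"
  proof (rule integral_mono)
    show "integrable circle (\<lambda>x. \<bar>f x * cos (real n * x)\<bar>)"
      unfolding f using assms by (simp add: integral_circle_cos_cos)
    show "\<bar>f x * cos (real n * x)\<bar> \<le> \<bar>f x\<bar>" for x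
      by (simp add: abs_mult mult_left_le)
  qed (use int in simp)
  also have "\<dots> \<le> sqrt (2*pi * (LINT x|circle. (f x)\<^sup>2))"
    by (rule circle_abs_integral_le[OF meas int2])
  \<comment> \<open>Enlarging 2 pi to pi^2 makes the constant cancel against the factor pi on the
    left.\<close>
  also have "\<dots> \<le> sqrt (pi\<^sup>2 * (norm (bh_profile n))\<^sup>2)"
  proof (intro real_sqrt_le_mono mult_mono)
    show "2 * pi \<le> pi\<^sup>2"
      using pi_ge_two by (simp add: power2_eq_square)
    show "(LINT x|circle. (f x)\<^sup>2) \<le> (norm (bh_profile n))\<^sup>2"
      using H1_norm_bounds(1)[OF has_weak_deriv_weak_deriv] by (simp add: f_def)
  qed auto
  also have "\<dots> = pi * norm (bh_profile n)"
    by (simp add: real_sqrt_mult)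
  finally show ?thesis
    by simp
qed

theorem theorem2:
  shows "conv_radius (\<lambda>n. (bh_profile n, bh_v n)) \<le> ereal (2 / exp 1)"
proof -
  have "conv_radius (\<lambda>n. (bh_profile n, bh_v n)) \<le> conv_radius (\<lambda>n. bh_u n n)"
  proof (rule conv_radius_mono)
    \<comment> \<open>Finitely many coefficients do not affect the radius, so the bound for n >= 2
      suffices; the norm of a pair dominates that of its first component.\<close>
    show "eventually (\<lambda>n. norm (bh_u n n) \<le> norm (bh_profile n, bh_v n)) sequentially"
      using eventually_ge_at_top[of 2]
    proof eventually_elim
      case (elim n)
      from bh_u_diag_le_norm[OF this] norm_fst_le show ?case
        by (auto intro: order_trans)
    qed
  qed
  then show ?thesis
    using conv_radius_bh_u_diag by (rule order_trans)
qed

end
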